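(* Let $(X,\tau,\mathcal{P})$ be a primal topological space. The following are equivalent: (1) $\tau$ is suitable for the primal $\mathcal{P}$; (2) for any $\tau^{\diamond}$-closed subset $A$ of $X$, $A^{c}\cup A^{\diamond}\notin\mathcal{P}$; (3) for any $A\subseteq X$, if for each $x\in A$ there exists some $U_x\in\tau(x)$ with $U_x^{c}\cup A^{c}\notin\mathcal{P}$, then $A^{c}\notin\mathcal{P}$; (4) for any $A\subseteq X$, if $A\cap A^{\diamond}=\emptyset$, then $A^{c}\notin\mathcal{P}$.
   Context: For a nonempty set $X$, $2^X$ is its power set and $A^c=X\setminus A$ is the complement of $A\subseteq X$. A primal on $X$ is a collection $\mathcal{P}\subseteq 2^X$ such that: (i) $X\notin\mathcal{P}$; (ii) if $A\in\mathcal{P}$ and $B\subseteq A$, then $B\in\mathcal{P}$; (iii) if $A\cap B\in\mathcal{P}$, then $A\in\mathcal{P}$ or $B\in\mathcal{P}$. A primal topological space $(X,\tau,\mathcal{P})$ is a topological space $(X,\tau)$ with a primal $\mathcal{P}$ on $X$. For $x\in X$, $\tau(x)$ is the family of all open (i.e. in $\tau$) sets containing $x$. For $A\subseteq X$, $A^{\diamond}=\{x\in X : A^c\cup U^c\in\mathcal{P}\text{ for all }U\in\tau(x)\}$ and $cl^{\diamond}(A)=A\cup A^{\diamond}$. The family $\tau^{\diamond}=\{A\subseteq X : cl^{\diamond}(A^c)=A^c\}$ is a topology on $X$ (the primal topology). The topology $\tau$ is said to be suitable for the primal $\mathcal{P}$ if $A^{c}\cup A^{\diamond}\notin\mathcal{P}$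 for all $A\subseteq X$. *)

theory Defs
  imports "HOL-Analysis.Abstract_Topology"
begin

text \<open>The ground set \<open>X\<close> is a carrier set, so all complements are taken relative to it.\<close>

definition primal_on :: "'a set \<Rightarrow> 'a set set \<Rightarrow> bool" where
  "primal_on X P \<longleftrightarrow>
     P \<subseteq> Pow X \<and>
     X \<notin> P \<and>
     (\<forall>A B. A \<in> P \<and> B \<subseteq> A \<longrightarrow> B \<in> P) \<and>
     (\<forall>A B. A \<subseteq> X \<and> B \<subseteq> X \<and> A \<inter> B \<in> P \<longrightarrow> A \<in> P \<or> B \<in> P)"

definition primal_space :: "'a topology \<Rightarrow> 'a set set \<Rightarrow> bool" where
  "primal_space T P \<longleftrightarrow> topspace T \<noteq> {} \<and> primal_on (topspace T) P"

definition open_nbhds :: "'a topology \<Rightarrow> 'a \<Rightarrow> 'a set set" where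
  "open_nbhds T x = {U. openin T U \<and> x \<in> U}"

definition diamond :: "'a topology \<Rightarrow> 'a set set \<Rightarrow> 'a set \<Rightarrow> 'a set" where
  "diamond T P A =
     {x \<in> topspace T. \<forall>U \<in> open_nbhds T x. (topspace T - A) \<union> (topspace T - U) \<in> P}"

definition cl_diamond :: "'a topology \<Rightarrow> 'a set set \<Rightarrow> 'a set \<Rightarrow> 'a set" where
  "cl_diamond T P A = A \<union> diamond T P A"

definition diamond_open :: "'a topology \<Rightarrow> 'a set set \<Rightarrow> 'a set \<Rightarrow> bool" where
  "diamond_open T P A \<longleftrightarrow>
     A \<subseteq> topspace T \<and> cl_diamond T P (topspace T - A) = topspace T - A"

text \<open>The type \<open>'a topology\<close> makes this well behaved only if \<open>diamond_open T P\<close> satisfies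
  the axioms of a topology; see \<open>openin_primal_topology\<close> and \<open>topspace_primal_topology\<close> below.\<close>

definition primal_topology :: "'a topology \<Rightarrow> 'a set set \<Rightarrow> 'a topology" where
  "primal_topology T P = topology (diamond_open T P)"

definition suitable :: "'a topology \<Rightarrow> 'a set set \<Rightarrow> bool" where
  "suitable T P \<longleftrightarrow>
     (\<forall>A. A \<subseteq> topspace T \<longrightarrow> (topspace T - A) \<union> diamond T P A \<notin> P)"

lemma diamond_mono:
  assumes P: "primal_space T P" and AB: "A \<subseteq> B"
  shows "diamond T P A \<subseteq> diamond T P B"
proof
  fix x assume x: "x \<in> diamond T P A"
  have down: "\<And>C D. C \<in> P \<Longrightarrow> D \<subseteq> C \<Longrightarrow> D \<in> P"
    using P unfolding primal_space_def primal_on_def by blast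
  have "(topspace T - B) \<union> (topspace T - U) \<in> P" if "U \<in> open_nbhds T x" for U
    by (rule down[of "(topspace T - A) \<union> (topspace T - U)"])
      (use x that AB in \<open>auto simp: diamond_def\<close>)
  then show "x \<in> diamond T P B"
    using x by (simp add: diamond_def)
qed

lemma diamond_Un:
  assumes P: "primal_space T P"
  shows "diamond T P (A \<union> B) = diamond T P A \<union> diamond T P B"
proof
  let ?X = "topspace T"
  have down: "\<And>C D. C \<in> P \<Longrightarrow> D \<subseteq> C \<Longrightarrow> D \<in> P"
    using P unfolding primal_space_def primal_on_def by blast
  have prime: "\<And>C D. C \<subseteq> ?X \<Longrightarrow> D \<subseteq> ?X \<Longrightarrow> C \<inter> D \<in> P \<Longrightarrow> C \<in> P \<or> D \<in> P"
    using P unfolding primal_space_def primal_on_def by blast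
  show "diamond T P (A \<union> B) \<subseteq> diamond T P A \<union> diamond T P B"
  proof (rule subsetI, rule ccontr)
    fix x assume x: "x \<in> diamond T P (A \<union> B)"
      and n: "x \<notin> diamond T P A \<union> diamond T P B"
    from x have xX: "x \<in> ?X" by (simp add: diamond_def)
    from n xX obtain U where U: "U \<in> open_nbhds T x" "(?X - A) \<union> (?X - U) \<notin> P"
      by (auto simp: diamond_def)
    from n xX obtain V where V: "V \<in> open_nbhds T x" "(?X - B) \<union> (?X - V) \<notin> P"
      by (auto simp: diamond_def)
    let ?W = "U \<inter> V"
    have "?W \<in> open_nbhds T x"
      using U V by (auto simp: open_nbhds_def)
    then have "(?X - (A \<union> B)) \<union> (?X - ?W) \<in> P"
      using x by (auto simp: diamond_def)
    moreover have "((?X - A) \<union> (?X - ?W)) \<inter> ((?X - B) \<union> (?X - ?W)) = (?X - (A \<union> B)) \<union> (?X - ?W)"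
      by blast
    ultimately have "(?X - A) \<union> (?X - ?W) \<in> P \<or> (?X - B) \<union> (?X - ?W) \<in> P"
      by (intro prime) auto
    then show False
    proof
      assume "(?X - A) \<union> (?X - ?W) \<in> P"
      then have "(?X - A) \<union> (?X - U) \<in> P" by (rule down) blast
      with U show False by simp
    next
      assume "(?X - B) \<union> (?X - ?W) \<in> P"
      then have "(?X - B) \<union> (?X - V) \<in> P" by (rule down) blast
      with V show False by simp
    qed
  qed
  show "diamond T P A \<union> diamond T P B \<subseteq> diamond T P (A \<union> B)"
    using diamond_mono[OF P] by (simp add: le_supI)
qed

lemma diamond_open_iff:
  "diamond_open T P A \<longleftrightarrow>
     A \<subseteq> topspace T \<and> diamond T P (topspace T - A) \<subseteq> topspace T - A"
  unfolding diamond_open_def cl_diamond_def by blast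

lemma istopology_diamond_open:
  assumes P: "primal_space T P"
  shows "istopology (diamond_open T P)"
  unfolding istopology_def
proof (intro conjI allI impI)
  fix A B assume AB: "diamond_open T P A" "diamond_open T P B"
  have "topspace T - A \<inter> B = (topspace T - A) \<union> (topspace T - B)" by blast
  then have "diamond T P (topspace T - A \<inter> B)
      = diamond T P (topspace T - A) \<union> diamond T P (topspace T - B)"
    by (simp add: diamond_Un[OF P])
  then show "diamond_open T P (A \<inter> B)"
    using AB unfolding diamond_open_iff by blast
next
  fix K assume K: "\<forall>A\<in>K. diamond_open T P A"
  have "diamond T P (topspace T - \<Union>K) \<subseteq> topspace T - A" if "A \<in> K" for A
  proof -
    have "diamond T P (topspace T - \<Union>K) \<subseteq> diamond T P (topspace T - A)"
      by (rule diamond_mono[OF P]) (use that in blast)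
    with K that show ?thesis unfolding diamond_open_iff by blast
  qed
  moreover have "diamond T P (topspace T - \<Union>K) \<subseteq> topspace T"
    by (auto simp: diamond_def)
  moreover have "\<Union>K \<subseteq> topspace T"
    using K unfolding diamond_open_iff by blast
  ultimately show "diamond_open T P (\<Union>K)"
    unfolding diamond_open_iff by blast
qed

lemma openin_primal_topology:
  "primal_space T P \<Longrightarrow> openin (primal_topology T P) = diamond_open T P"
  unfolding primal_topology_def
  by (rule topology_inverse'[OF istopology_diamond_open])

lemma topspace_primal_topology:
  assumes P: "primal_space T P"
  shows "topspace (primal_topology T P) = topspace T"
proof
  show "topspace (primal_topology T P) \<subseteq> topspace T"
    unfolding topspace_def[of "primal_topology T P"]
    by (auto simp: openin_primal_topology[OF P] diamond_open_def)
  have "topspace T \<notin> P"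
    using P unfolding primal_space_def primal_on_def by blast
  then have "diamond_open T P (topspace T)"
    unfolding diamond_open_iff by (auto simp: diamond_def open_nbhds_def)
  then show "topspace T \<subseteq> topspace (primal_topology T P)"
    using openin_subset[of "primal_topology T P" "topspace T"]
    by (simp add: openin_primal_topology[OF P])
qed

end

theory Submission
  imports Defs
begin

text \<open>Call \<open>A \<subseteq> X\<close> small if its complement is not in \<open>P\<close>. The axioms of a primal say that
  subsets and finite unions of small sets are small. Since
  \<open>A\<^sup>c \<union> U\<^sup>c = (A \<inter> U)\<^sup>c\<close>, the set \<open>A\<^sup>\<diamond>\<close> consists of the points at which \<open>A\<close> is not
  locally small, and since \<open>A\<^sup>c \<union> A\<^sup>\<diamond> = (A - A\<^sup>\<diamond>)\<^sup>c\<close>, suitability says that the part of \<open>A\<close>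
  where \<open>A\<close> is locally small is small. The condition on the neighbourhoods \<open>U\<^sub>x\<close> and the condition
  on sets with \<open>A \<inter> A\<^sup>\<diamond> = {}\<close> both say that a set which is locally small at each of its own
  points is small, so they agree.

  This implies suitability because \<open>A - A\<^sup>\<diamond>\<close> is disjoint from its own diamond, by monotonicity
  (lemma \<open>suitableI\<close>). Suitability specializes to closed sets. To return from closed sets to a set
  \<open>A\<close> disjoint from \<open>A\<^sup>\<diamond>\<close>, consider \<open>cl\<^sup>\<diamond>(A)\<close>. The diamond is additive and
  \<open>A\<^sup>\<diamond>\<^sup>\<diamond> \<subseteq> A\<^sup>\<diamond>\<close> (lemma \<open>diamond_diamond_subset\<close>), so \<open>cl\<^sup>\<diamond>(A)\<close> is closed and has the same
  diamond as \<open>A\<close>; removing that diamond from it leaves \<open>A\<close> itself, which is therefore small.\<close>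

lemma diamond_subset_topspace: "diamond T P A \<subseteq> topspace T"
  by (auto simp: diamond_def)

text \<open>If \<open>U\<close> is an open neighbourhood of \<open>x\<close> in which \<open>A\<close> is small, then \<open>U\<close> witnesses local
  smallness at all its points and so misses \<open>A\<^sup>\<diamond>\<close>. If \<open>x\<close> were in \<open>A\<^sup>\<diamond>\<^sup>\<diamond>\<close>, the complement of
  \<open>A\<^sup>\<diamond> \<inter> U\<close>, which is all of \<open>X\<close>, would lie in \<open>P\<close>.\<close>

lemma diamond_diamond_subset:
  assumes P: "primal_space T P"
  shows "diamond T P (diamond T P A) \<subseteq> diamond T P A"
proof (rule subsetI, rule ccontr)
  fix x assume x: "x \<in> diamond T P (diamond T P A)" and n: "x \<notin> diamond T P A"
  from x have "x \<in> topspace T" by (simp add: diamond_def)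
  with n obtain U where U: "U \<in> open_nbhds T x" "(topspace T - A) \<union> (topspace T - U) \<notin> P"
    by (auto simp: diamond_def)
  have "U \<inter> diamond T P A = {}"
    using U by (auto simp: diamond_def open_nbhds_def)
  then have "(topspace T - diamond T P A) \<union> (topspace T - U) = topspace T" by blast
  with x U(1) have "topspace T \<in> P" by (auto simp: diamond_def)
  with P show False by (simp add: primal_space_def primal_on_def)
qed

lemma diamond_cl_diamond:
  assumes P: "primal_space T P"
  shows "diamond T P (cl_diamond T P A) = diamond T P A"
  using diamond_diamond_subset[OF P, of A] by (auto simp: cl_diamond_def diamond_Un[OF P])

lemma closedin_primal_topology_iff:
  assumes P: "primal_space T P"
  shows "closedin (primal_topology T P) A \<longleftrightarrow> A \<subseteq> topspace T \<and> diamond T P A \<subseteq> A"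
  by (auto simp: closedin_def topspace_primal_topology[OF P] openin_primal_topology[OF P]
      diamond_open_iff double_diff)

lemma closedin_cl_diamond:
  assumes P: "primal_space T P" and A: "A \<subseteq> topspace T"
  shows "closedin (primal_topology T P) (cl_diamond T P A)"
  unfolding closedin_primal_topology_iff[OF P] diamond_cl_diamond[OF P]
  using A diamond_subset_topspace[of T P A] by (auto simp: cl_diamond_def)

lemma disjoint_diamond_iff:
  assumes "A \<subseteq> topspace T"
  shows "A \<inter> diamond T P A = {} \<longleftrightarrow>
    (\<forall>x\<in>A. \<exists>U \<in> open_nbhds T x. (topspace T - U) \<union> (topspace T - A) \<notin> P)"
  using assms by (auto simp: diamond_def Un_commute)

text \<open>The hypothesis is applied to \<open>A - A\<^sup>\<diamond>\<close>: its diamond lies in \<open>A\<^sup>\<diamond>\<close>, hence is disjoint from it.\<close>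

lemma suitableI:
  assumes P: "primal_space T P"
    and small: "\<And>A. A \<subseteq> topspace T \<Longrightarrow> A \<inter> diamond T P A = {} \<Longrightarrow> topspace T - A \<notin> P"
  shows "suitable T P"
  unfolding suitable_def
proof (intro allI impI)
  fix A assume A: "A \<subseteq> topspace T"
  let ?B = "A - diamond T P A"
  have "?B \<inter> diamond T P ?B = {}"
    using diamond_mono[OF P, of ?B A] by blast
  moreover have "topspace T - ?B = (topspace T - A) \<union> diamond T P A"
    using diamond_subset_topspace[of T P A] by blast
  ultimately show "(topspace T - A) \<union> diamond T P A \<notin> P"
    using small[of ?B] A by auto
qed

text \<open>The closure is the right closed set to test because
  \<open>cl\<^sup>\<diamond>(A) - (cl\<^sup>\<diamond>(A))\<^sup>\<diamond> = A\<close> when \<open>A\<close> and \<open>A\<^sup>\<diamond>\<close> are disjoint.\<close>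

lemma compl_notin_primal_if_disjoint_diamond:
  assumes P: "primal_space T P"
    and closed: "\<And>C. closedin (primal_topology T P) C \<Longrightarrow> (topspace T - C) \<union> diamond T P C \<notin> P"
    and A: "A \<subseteq> topspace T" and disj: "A \<inter> diamond T P A = {}"
  shows "topspace T - A \<notin> P"
proof -
  have "(topspace T - cl_diamond T P A) \<union> diamond T P A = topspace T - A"
    using disj diamond_subset_topspace[of T P A] by (auto simp: cl_diamond_def)
  then show ?thesis
    using closed[OF closedin_cl_diamond[OF P A]] by (simp add: diamond_cl_diamond[OF P])
qed

theorem theorem4p2:
  fixes T :: "'a topology" and P :: "'a set set"
  assumes "primal_space T P"
  defines "X \<equiv> topspace T"
  shows "(suitable T P \<longleftrightarrow>
            (\<forall>A. closedin (primal_topology T P) A \<longrightarrow> (X - A) \<union> diamond T P A \<notin> P))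
       \<and> (suitable T P \<longleftrightarrow>
            (\<forall>A \<subseteq> X. (\<forall>x \<in> A. \<exists>U \<in> open_nbhds T x. (X - U) \<union> (X - A) \<notin> P) \<longrightarrow> X - A \<notin> P))
       \<and> (suitable T P \<longleftrightarrow>
            (\<forall>A \<subseteq> X. A \<inter> diamond T P A = {} \<longrightarrow> X - A \<notin> P))"
    (is "(_ \<longleftrightarrow> ?closed) \<and> (_ \<longleftrightarrow> ?local) \<and> (_ \<longleftrightarrow> ?disjoint)")
proof -
  have "suitable T P \<Longrightarrow> ?closed"
    by (auto simp: suitable_def X_def closedin_primal_topology_iff[OF assms(1)])
  moreover have "?closed \<Longrightarrow> ?disjoint"
    using compl_notin_primal_if_disjoint_diamond[OF assms(1)] unfolding X_def by blast
  moreover have "?disjoint \<Longrightarrow> suitable T P"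
    using suitableI[OF assms(1)] unfolding X_def by blast
  moreover have "?local \<longleftrightarrow> ?disjoint"
    unfolding X_def by (simp add: disjoint_diamond_iff)
  ultimately show ?thesis by blast
qed

end
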